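(* Let $K\ge2$, and let $\mathbb P_{\boldsymbol b}$ be the uniform probability measure over permutations $\boldsymbol b$ of $\{1,\ldots,N\}$, conditional on $\{Z_1,\ldots,Z_N\}$. For distinct $k,l\in\{1,\ldots,K\}$ let $\gamma_{k,l}=n_kn_l/(n_k+n_l)^2$, and let $\widehat\sigma_K^2$ be the quantity defined in the context. Then for any $t\ge0$, $$\mathbb P_{\boldsymbol b}\left\{\widehat{\mathcal V}_{h,\max}^{(\boldsymbol b)}\ge t+\max_{1\le k<l\le K}\sqrt{\frac{\widehat\sigma_K^2}{2(n_k+n_l)\gamma_{k,l}}}\right\}\le\binom K2\exp\left\{-\min_{1\le k<l\le K}\frac{(n_k+n_l)\gamma_{k,l}^2t^2}{2\widehat\sigma_K^2}\right\}.$$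
   Context: $h:\mathcal X\times\mathcal X\to\mathbb R$ is the reproducing kernel of a reproducing kernel Hilbert space $\mathcal H$ on $\mathcal X$ with feature map $\psi:\mathcal X\to\mathcal H$, $h(x,y)=\langle\psi(x),\psi(y)\rangle_{\mathcal H}$. There are $K$ samples of sizes $n_1,\ldots,n_K\ge1$, with $N=\sum_{k=1}^Kn_k$ and pooled sample $\{Z_1,\ldots,Z_N\}=\{X_{1,1},\ldots,X_{n_1,1},\ldots,X_{1,K},\ldots,X_{n_K,K}\}$ (in this order), consisting of points of $\mathcal X$ held fixed under $\mathbb P_{\boldsymbol b}$. Put $m_0=0$ and $m_{l}=\sum_{k=1}^{l}n_k$. For a permutation $\boldsymbol b=(b_1,\ldots,b_N)$ of $\{1,\ldots,N\}$ the permuted statistic is $$\widehat{\mathcal V}_{h,\max}^{(\boldsymbol b)}=\max_{1\le k<l\le K}\Big\|\frac1{n_k}\sum_{i=1}^{n_k}\psi(Z_{b_{m_{k-1}+i}})-\frac1{n_l}\sum_{j=1}^{n_l}\psi(Z_{b_{m_{l-1}+j}})\Big\|_{\mathcal H}.$$ Definition of $\widehat\sigma_K^2$: let $\widetilde h(Z_i,Z_j)=h(Z_i,Z_i)+h(Z_j,Z_j)-2h(Z_i,Z_j)$. Sort the $N(N-1)$ values $\widetilde h(Z_i,Z_j)$ over ordered pairs $(i,j)$, $1\le i\ne j\le N$, as $\widetilde h_{[1]}\ge\cdots\ge\widetilde h_{[N(N-1)]}$. For $1\le k<l\le K$ let $\overline\sigma_{kl}^2$ be the average of the $(n_k+n_l)(n_k+n_l-1)$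 largest values $\widetilde h_{[1]},\ldots,\widetilde h_{[(n_k+n_l)(n_k+n_l-1)]}$. Then $\widehat\sigma_K^2=\max_{1\le k<l\le K}\overline\sigma_{kl}^2$. When $\widehat\sigma_K^2=0$, the exponential on the right-hand side is read as $0$ if $t>0$ and as $1$ if $t=0$. *)

theory Defs
  imports "HOL-Probability.Probability" "HOL-Combinatorics.Permutations"
begin

text \<open>
  A reproducing kernel Hilbert space on the point set \<open>'x\<close>: the elements of the Hilbert space
  \<open>'h\<close> are identified with real functions on \<open>'x\<close> through the injection \<open>evalf\<close>
  (\<open>evalf f x\<close> is the value of \<open>f\<close> at \<open>x\<close>), and all point evaluations are
  continuous linear functionals.
\<close>

definition rkhs :: "('h::{real_inner,complete_space} \<Rightarrow> 'x \<Rightarrow> real) \<Rightarrow> bool" where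
  "rkhs evalf \<longleftrightarrow> inj evalf \<and> (\<forall>x. bounded_linear (\<lambda>f. evalf f x))"

definition reproducing_kernel ::
  "('h::{real_inner,complete_space} \<Rightarrow> 'x \<Rightarrow> real) \<Rightarrow> ('x \<Rightarrow> 'x \<Rightarrow> real) \<Rightarrow> bool" where
  "reproducing_kernel evalf h \<longleftrightarrow>
     (\<forall>x. \<exists>g. (\<forall>y. evalf g y = h y x) \<and> (\<forall>f. evalf f x = inner f g))"

definition feature_map :: "('x \<Rightarrow> 'h::{real_inner,complete_space}) \<Rightarrow> ('x \<Rightarrow> 'x \<Rightarrow> real) \<Rightarrow> bool" where
  "feature_map \<psi> h \<longleftrightarrow> (\<forall>x y. h x y = inner (\<psi> x) (\<psi> y))"

text \<open>
  Samples and observations are numbered from 1: \<open>X i k\<close> is the \<open>i\<close>-th observation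
  of the \<open>k\<close>-th sample, for \<open>1 \<le> k \<le> K\<close> and \<open>1 \<le> i \<le> n k\<close>.
\<close>

definition cum_size :: "(nat \<Rightarrow> nat) \<Rightarrow> nat \<Rightarrow> nat" where
  "cum_size n l = (\<Sum>k=1..l. n k)"

text \<open>The index shift is needed because list positions start at 0; only the values at
  \<open>1, \<dots>, cum_size n K\<close> are meaningful.\<close>

definition pooled_sample :: "nat \<Rightarrow> (nat \<Rightarrow> nat) \<Rightarrow> (nat \<Rightarrow> nat \<Rightarrow> 'x) \<Rightarrow> nat \<Rightarrow> 'x" where
  "pooled_sample K n X j =
     concat (map (\<lambda>k. map (\<lambda>i. X i k) [1..<Suc (n k)]) [1..<Suc K]) ! (j - 1)"

lemma length_pooled_list:
  "length (concat (map (\<lambda>k. map (\<lambda>i. X i k) [1..<Suc (n k)]) [1..<Suc K])) = cum_size n K"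
  by (induction K) (simp_all add: cum_size_def)

lemma pooled_sample_eq:
  assumes "k \<in> {1..K}" "i \<in> {1..n k}"
  shows "pooled_sample K n X (cum_size n (k - 1) + i) = X i k"
  using assms
proof (induction K)
  case (Suc K)
  define L where "L = concat (map (\<lambda>k. map (\<lambda>i. X i k) [1..<Suc (n k)]) [1..<Suc K])"
  have len: "length L = cum_size n K"
    unfolding L_def by (rule length_pooled_list)
  have split: "concat (map (\<lambda>k. map (\<lambda>i. X i k) [1..<Suc (n k)]) [1..<Suc (Suc K)]) =
      L @ map (\<lambda>i. X i (Suc K)) [1..<Suc (n (Suc K))]"
    by (simp add: L_def)
  show ?case
  proof (cases "k = Suc K")
    case True
    then show ?thesis
      using Suc.prems unfolding pooled_sample_def split
      by (auto simp: nth_append len simp del: upt_Suc)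
  next
    case False
    then have k: "k \<in> {1..K}" using Suc.prems by auto
    have "cum_size n (k - 1) + n k = cum_size n k"
      using k by (cases k) (simp_all add: cum_size_def)
    also have "\<dots> \<le> cum_size n K"
      unfolding cum_size_def using k by (intro sum_mono2) auto
    finally have "cum_size n (k - 1) + i - 1 < length L"
      using Suc.prems len by auto
    then show ?thesis
      using Suc.IH k Suc.prems unfolding pooled_sample_def split L_def[symmetric]
      by (simp add: nth_append)
  qed
qed simp

definition index_pairs :: "nat \<Rightarrow> (nat \<times> nat) set" where
  "index_pairs K = {(k, l). 1 \<le> k \<and> k < l \<and> l \<le> K}"

definition permuted_mean ::
  "('x \<Rightarrow> 'h::{real_inner,complete_space}) \<Rightarrow> (nat \<Rightarrow> 'x) \<Rightarrow> (nat \<Rightarrow> nat) \<Rightarrow> (nat \<Rightarrow> nat) \<Rightarrow> nat \<Rightarrow> 'h"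
  where
  "permuted_mean \<psi> Z n b k =
     (1 / real (n k)) *\<^sub>R (\<Sum>i=1..n k. \<psi> (Z (b (cum_size n (k - 1) + i))))"

definition V_max ::
  "('x \<Rightarrow> 'h::{real_inner,complete_space}) \<Rightarrow> (nat \<Rightarrow> 'x) \<Rightarrow> nat \<Rightarrow> (nat \<Rightarrow> nat) \<Rightarrow> (nat \<Rightarrow> nat) \<Rightarrow> real"
  where
  "V_max \<psi> Z K n b =
     Max ((\<lambda>(k, l). norm (permuted_mean \<psi> Z n b k - permuted_mean \<psi> Z n b l)) ` index_pairs K)"

definition h_tilde :: "('x \<Rightarrow> 'x \<Rightarrow> real) \<Rightarrow> 'x \<Rightarrow> 'x \<Rightarrow> real" where
  "h_tilde h x y = h x x + h y y - 2 * h x y"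

definition sorted_h_tilde :: "('x \<Rightarrow> 'x \<Rightarrow> real) \<Rightarrow> (nat \<Rightarrow> 'x) \<Rightarrow> nat \<Rightarrow> real list" where
  "sorted_h_tilde h Z N =
     rev (sort [h_tilde h (Z i) (Z j). i \<leftarrow> [1..<Suc N], j \<leftarrow> [1..<Suc N], i \<noteq> j])"

definition sigma_bar_sq ::
  "('x \<Rightarrow> 'x \<Rightarrow> real) \<Rightarrow> (nat \<Rightarrow> 'x) \<Rightarrow> nat \<Rightarrow> (nat \<Rightarrow> nat) \<Rightarrow> nat \<Rightarrow> nat \<Rightarrow> real" where
  "sigma_bar_sq h Z N n k l =
     (let c = (n k + n l) * (n k + n l - 1)
      in sum_list (take c (sorted_h_tilde h Z N)) / real c)"

definition sigma_hat_sq ::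
  "('x \<Rightarrow> 'x \<Rightarrow> real) \<Rightarrow> (nat \<Rightarrow> 'x) \<Rightarrow> nat \<Rightarrow> nat \<Rightarrow> (nat \<Rightarrow> nat) \<Rightarrow> real" where
  "sigma_hat_sq h Z N K n = Max ((\<lambda>(k, l). sigma_bar_sq h Z N n k l) ` index_pairs K)"

definition gamma_ratio :: "(nat \<Rightarrow> nat) \<Rightarrow> nat \<Rightarrow> nat \<Rightarrow> real" where
  "gamma_ratio n k l = real (n k) * real (n l) / (real (n k + n l))\<^sup>2"

end

theory Submission imports Defs "HOL-Library.Ramsey" begin

text \<open>
  By a union bound it suffices to control, for each pair \<open>k < l\<close>, the distance between
  the means of the permuted \<open>k\<close>-th and \<open>l\<close>-th samples. Let \<open>S\<close> be the set of the
  \<open>M = n k + n l\<close> pooled indices that the permutation assigns to these two samples and let \<open>A\<close> be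
  the part of \<open>S\<close> assigned to the \<open>k\<close>-th one. The pair \<open>(S, A)\<close> is uniformly distributed
  (\<open>sum_permutations_images\<close>), so \<open>S\<close> may be held fixed while \<open>A\<close> is a uniform
  \<open>n k\<close>-element subset of \<open>S\<close>. With \<open>D\<close> the sum of the squared distances of the feature
  vectors over the ordered pairs from \<open>S\<close>, the average \<open>D / (M (M - 1))\<close> is at most
  \<open>sigma_bar_sq\<close>, because that quantity averages the \<open>M (M - 1)\<close> largest squared distances
  (\<open>sum_pairwise_le_sigma_bar_sq\<close>).

  The threshold bounds the expectation: a second moment computation
  (\<open>sum_norm_sq_mean_difference\<close>) gives the mean square of the distance exactly, and its root is
  at most the square root in the statement.

  The deviation above the expectation is bounded by a Hoeffding martingale argument, carried out as
  an induction on \<open>S\<close> (\<open>swap_lipschitz_mgf\<close>). Decide for one element \<open>i\<close> after the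
  other whether it belongs to \<open>A\<close>. The two conditional expectations differ by at most the average
  effect of exchanging \<open>i\<close> with a uniformly chosen remaining element
  (\<open>average_nsets_swap\<close>), and its square is at most the average squared effect. Always
  deciding next for an element whose sum of squared distances to the remaining ones is at least the
  average makes the sum of these squared ranges at most a multiple of \<open>D / M\<close>, so that the
  average of the squared distances enters the exponent, rather than their maximum. Chernoff's bound
  then yields an exponent four times as large as the one claimed.
\<close>

section \<open>Exponential moments of functions of a random subset\<close>

lemma two_point_mgf_bound:
  fixes p x y :: real
  assumes "0 \<le> p" "p \<le> 1"
  shows "p * exp x + (1 - p) * exp y \<le> exp (p * x + (1 - p) * y + (x - y)\<^sup>2 / 8)"
proof -
  have ordered: "p * exp x + (1 - p) * exp y \<le> exp (p * x + (1 - p) * y + (x - y)\<^sup>2 / 8)"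
    if "0 \<le> p" "p \<le> 1" "y \<le> x" for p x y :: real
  proof -
    define u where "u = x - y"
    have u: "u \<ge> 0" and x: "x = y + u" using that by (simp_all add: u_def)
    have pos: "1 + p * (exp u - 1) > 0"
      using that u by (intro add_pos_nonneg mult_nonneg_nonneg) auto
    have "ln (1 + p * (exp u - 1)) \<le> u * p + u\<^sup>2 / 8"
      using Hoeffdings_lemma_aux[OF u that(1)] by simp
    then have le: "1 + p * (exp u - 1) \<le> exp (u * p + u\<^sup>2 / 8)"
      using pos by (metis exp_le_cancel_iff exp_ln)
    have "p * exp x + (1 - p) * exp y = exp y * (1 + p * (exp u - 1))"
      unfolding x by (simp add: exp_add algebra_simps)
    also have "\<dots> \<le> exp y * exp (u * p + u\<^sup>2 / 8)"
      using le by simp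
    also have "\<dots> = exp (p * x + (1 - p) * y + (x - y)\<^sup>2 / 8)"
      unfolding x by (simp add: algebra_simps flip: exp_add)
    finally show ?thesis .
  qed
  show ?thesis
  proof (cases "y \<le> x")
    case False
    then show ?thesis
      using ordered[of "1 - p" x y] assms by (simp add: power2_commute algebra_simps)
  qed (use ordered assms in simp)
qed

lemma sum_nsets_insert:
  fixes g :: "'a set \<Rightarrow> real"
  assumes "finite S" "i \<notin> S"
  shows "(\<Sum>A\<in>nsets (insert i S) (Suc k). g A) =
    (\<Sum>A\<in>nsets S k. g (insert i A)) + (\<Sum>A\<in>nsets S (Suc k). g A)"
proof -
  have split: "nsets (insert i S) (Suc k) = insert i ` nsets S k \<union> nsets S (Suc k)"
  proof (intro equalityI subsetI)
    fix A assume A: "A \<in> nsets (insert i S) (Suc k)"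
    show "A \<in> insert i ` nsets S k \<union> nsets S (Suc k)"
    proof (cases "i \<in> A")
      case True
      then have "A = insert i (A - {i})" by auto
      moreover have "A - {i} \<in> nsets S k" using A True by (auto simp: nsets_def)
      ultimately show ?thesis by blast
    qed (use A in \<open>auto simp: nsets_def\<close>)
  qed (use assms in \<open>auto simp: nsets_def card_insert_if\<close>)
  have inj: "inj_on (insert i) (nsets S k)"
    using assms by (auto simp: inj_on_def nsets_def)
  show ?thesis
    unfolding split
    by (subst sum.union_disjoint)
       (use assms inj in \<open>auto simp: sum.reindex finite_imp_finite_nsets, auto simp: nsets_def\<close>)
qed

lemma sum_nsets_remove_element:
  fixes g :: "'a set \<Rightarrow> 'a \<Rightarrow> real"
  assumes "finite S"
  shows "(\<Sum>A\<in>nsets S k. \<Sum>c\<in>S - A. g A c) = (\<Sum>B\<in>nsets S (Suc k). \<Sum>c\<in>B. g (B - {c}) c)"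
proof -
  have "(\<Sum>A\<in>nsets S k. \<Sum>c\<in>S - A. g A c) = (\<Sum>(A, c)\<in>Sigma (nsets S k) (\<lambda>A. S - A). g A c)"
    using assms by (subst sum.Sigma) (auto simp: finite_imp_finite_nsets)
  also have "\<dots> = (\<Sum>(B, c)\<in>Sigma (nsets S (Suc k)) (\<lambda>B. B). g (B - {c}) c)"
    by (rule sum.reindex_bij_witness[where i = "\<lambda>(B, c). (B - {c}, c)" and j = "\<lambda>(A, c). (insert c A, c)"])
       (use assms in \<open>auto simp: nsets_def finite_subset insert_absorb card_insert_if\<close>)
  also have "\<dots> = (\<Sum>B\<in>nsets S (Suc k). \<Sum>c\<in>B. g (B - {c}) c)"
    using assms by (subst sum.Sigma) (auto simp: finite_imp_finite_nsets, auto simp: nsets_def)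
  finally show ?thesis .
qed

text \<open>
  Add \<open>i\<close> to a uniform \<open>k\<close>-element subset \<open>A\<close> of \<open>S\<close>, and compare with adding
  to \<open>A\<close> a uniform element of \<open>S - A\<close>. The latter is a uniform subset with \<open>k + 1\<close>
  elements, and the element added is uniform in \<open>S\<close>.
\<close>

lemma average_nsets_swap:
  fixes f :: "'a set \<Rightarrow> real" and d :: "'a \<Rightarrow> real"
  assumes "finite S" "Suc k \<le> card S"
    and swap: "\<And>A c. A \<subseteq> S \<Longrightarrow> c \<in> S - A \<Longrightarrow> \<bar>f (insert i A) - f (insert c A)\<bar> \<le> d c"
  shows "\<bar>(\<Sum>A\<in>nsets S k. f (insert i A)) / real (card S choose k)
          - (\<Sum>A\<in>nsets S (Suc k). f A) / real (card S choose Suc k)\<bar> \<le> (\<Sum>c\<in>S. d c) / real (card S)"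
proof -
  define s where "s = card S"
  define a where "a = real (s choose k)"
  define b where "b = real (s choose Suc k)"
  define e where "e = real ((s - 1) choose k)"
  define F1 where "F1 = (\<Sum>A\<in>nsets S k. f (insert i A))"
  define F0 where "F0 = (\<Sum>A\<in>nsets S (Suc k). f A)"
  have s: "Suc k \<le> s" "s > 0" using assms by (auto simp: s_def)
  have pos: "a > 0" "b > 0" "e > 0" using s by (auto simp: a_def b_def e_def)
  \<comment> \<open>The number \<open>real s * e\<close> of pairs of a \<open>k\<close>-element set and a point outside it, counted in two ways.\<close>
  have "(s - k) * (s choose k) = s * ((s - 1) choose k)" by (rule binomial_absorb_comp)
  then have ea: "(real s - real k) * a = real s * e"
    using s unfolding a_def e_def by (metis of_nat_mult of_nat_diff Suc_leD)
  have "Suc k * (s choose Suc k) = s * ((s - 1) choose k)"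
    by (rule binomial_absorption)
  then have eb: "(real k + 1) * b = real s * e"
    unfolding b_def e_def by (metis of_nat_mult of_nat_Suc add.commute)
  have "(\<Sum>A\<in>nsets S k. \<Sum>c\<in>S - A. f (insert i A)) = (real s - real k) * F1"
    unfolding F1_def sum_distrib_left
    by (intro sum.cong refl)
       (use assms(1) s in \<open>auto simp: nsets_def card_Diff_subset s_def of_nat_diff\<close>)
  moreover have "(\<Sum>A\<in>nsets S k. \<Sum>c\<in>S - A. f (insert c A)) = (real k + 1) * F0"
    unfolding F0_def sum_distrib_left
    by (subst sum_nsets_remove_element[OF assms(1), of "\<lambda>A c. f (insert c A)"], intro sum.cong refl)
       (auto simp: nsets_def insert_absorb add.commute)
  ultimately have "(real s - real k) * F1 - (real k + 1) * F0 =
      (\<Sum>A\<in>nsets S k. \<Sum>c\<in>S - A. f (insert i A) - f (insert c A))"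
    by (simp add: sum_subtractf)
  also have "\<bar>\<dots>\<bar> \<le> (\<Sum>A\<in>nsets S k. \<Sum>c\<in>S - A. d c)"
    by (intro order.trans[OF sum_abs] sum_mono swap) (auto simp: nsets_def)
  also have "\<dots> = (\<Sum>A\<in>nsets S k. \<Sum>c\<in>S. if c \<notin> A then d c else 0)"
    using assms(1) by (intro sum.cong sum.mono_neutral_cong_left refl) auto
  also have "\<dots> = (\<Sum>c\<in>S. \<Sum>A\<in>nsets S k. if c \<notin> A then d c else 0)"
    by (rule sum.swap)
  also have "\<dots> = (\<Sum>c\<in>S. e * d c)"
  proof (intro sum.cong refl)
    fix c assume c: "c \<in> S"
    have "nsets S k \<inter> {A. c \<notin> A} = nsets (S - {c}) k" by (auto simp: nsets_def)
    moreover have "card (nsets (S - {c}) k) = (s - 1) choose k"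
      using assms(1) c by (simp add: card_nsets s_def)
    ultimately show "(\<Sum>A\<in>nsets S k. if c \<notin> A then d c else 0) = e * d c"
      using assms(1) by (simp add: sum.If_cases finite_imp_finite_nsets e_def)
  qed
  also have "\<dots> = e * (\<Sum>c\<in>S. d c)" by (simp add: sum_distrib_left)
  finally have main: "\<bar>(real s - real k) * F1 - (real k + 1) * F0\<bar> \<le> e * (\<Sum>c\<in>S. d c)" .
  have "(real s - real k) * F1 = real s * e * (F1 / a)"
    using pos by (simp flip: ea)
  moreover have "(real k + 1) * F0 = real s * e * (F0 / b)"
    using pos by (simp flip: eb)
  ultimately have "(real s - real k) * F1 - (real k + 1) * F0 = real s * e * (F1 / a - F0 / b)"
    by (simp add: right_diff_distrib)
  with main have "\<bar>real s * e * (F1 / a - F0 / b)\<bar> \<le> e * (\<Sum>c\<in>S. d c)"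
    by simp
  then have "e * (real s * \<bar>F1 / a - F0 / b\<bar>) \<le> e * (\<Sum>c\<in>S. d c)"
    using pos by (simp add: abs_mult mult.assoc mult.left_commute)
  then have "real s * \<bar>F1 / a - F0 / b\<bar> \<le> (\<Sum>c\<in>S. d c)"
    using pos by simp
  then show ?thesis
    using s by (simp add: field_simps F1_def F0_def a_def b_def s_def)
qed

text \<open>
  Hoeffding's inequality for sampling without replacement, in exponential form: \<open>d i c\<close> bounds
  the effect of replacing \<open>i\<close> by \<open>c\<close> in the sample. The usual parameter of the moment
  generating function is absorbed into \<open>f\<close> and \<open>d\<close>.
\<close>

lemma swap_lipschitz_mgf:
  fixes f :: "'a set \<Rightarrow> real" and d :: "'a \<Rightarrow> 'a \<Rightarrow> real"
  assumes "finite S" "k \<le> card S"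
    and sym: "\<And>i j. d i j = d j i" and diag: "\<And>i. d i i = 0"
    and swap: "\<And>A i c. A \<subseteq> S \<Longrightarrow> i \<in> S - A \<Longrightarrow> c \<in> S - A \<Longrightarrow> i \<noteq> c \<Longrightarrow>
      \<bar>f (insert i A) - f (insert c A)\<bar> \<le> d i c"
  shows "(\<Sum>A\<in>nsets S k. exp (f A)) \<le> real (card S choose k) *
     exp ((\<Sum>A\<in>nsets S k. f A) / real (card S choose k)
          + (\<Sum>i\<in>S. \<Sum>j\<in>S. (d i j)\<^sup>2) / (8 * real (card S)))"
  using assms(1,2) swap
proof (induction "card S" arbitrary: S k f)
  case 0
  then have "nsets S k = {{}}" by (auto simp: nsets_def)
  then show ?case using 0 by simp
next
  case (Suc s)
  define D where "D = (\<lambda>S. \<Sum>i\<in>S. \<Sum>j\<in>S. (d i j)\<^sup>2)"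
  have D_nonneg: "D T \<ge> 0" for T unfolding D_def by (intro sum_nonneg) auto
  have card: "card S = Suc s" using Suc.hyps by simp
  consider "k = 0" | "k = Suc s" | k' where "k = Suc k'" "Suc k' \<le> s"
    using Suc.prems card by (cases k) force+
  then show ?case
  proof cases
    case 1
    then have "nsets S k = {{}}" by (auto simp: nsets_def)
    then show ?thesis using 1 D_nonneg[of S] by (simp add: D_def)
  next
    case 2
    then have "A \<in> nsets S k \<longleftrightarrow> A = S" for A
      using card Suc.prems(1) card_subset_eq[of S A] by (auto simp: nsets_def)
    then have "nsets S k = {S}" by blast
    then show ?thesis using 2 card D_nonneg[of S] by (simp add: D_def)
  next
    case (3 k')
    define M where "M = real (card S)"
    have s: "s > 0" using 3 by simp
    have M: "M = real s + 1" by (simp add: M_def card)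
    \<comment> \<open>An element whose share of the squared distances is at least the average share.\<close>
    have ex: "\<exists>i\<in>S. D S / M \<le> (\<Sum>j\<in>S. (d i j)\<^sup>2)"
    proof (rule ccontr)
      assume "\<not> ?thesis"
      then have "(\<Sum>i\<in>S. \<Sum>j\<in>S. (d i j)\<^sup>2) < (\<Sum>i\<in>S. D S / M)"
        using Suc.prems(1) card by (intro sum_strict_mono) auto
      also have "\<dots> = D S" by (simp add: M_def card)
      finally show False by (simp add: D_def)
    qed
    then obtain i where i: "i \<in> S" "D S / M \<le> (\<Sum>j\<in>S. (d i j)\<^sup>2)" by blast
    define T where "T = S - {i}"
    define r where "r = (\<Sum>j\<in>T. (d i j)\<^sup>2)"
    have T: "finite T" "i \<notin> T" "S = insert i T" "card T = s" "T \<subseteq> S"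
      using Suc.prems(1) i card by (auto simp: T_def)
    have r: "D S / M \<le> r" using i(2) T by (simp add: r_def diag)
    have DS: "D S = D T + 2 * r"
      using T by (simp add: D_def r_def diag sum.distrib sym[of _ i])
    define a where "a = real (s choose k')"
    define b where "b = real (s choose Suc k')"
    define F1 where "F1 = (\<Sum>A\<in>nsets T k'. f (insert i A))"
    define F0 where "F0 = (\<Sum>A\<in>nsets T (Suc k'). f A)"
    define m1 where "m1 = F1 / a"
    define m0 where "m0 = F0 / b"
    define p where "p = a / (a + b)"
    have pos: "a > 0" "b > 0" using 3 by (simp_all add: a_def b_def)
    have p: "0 \<le> p" "p \<le> 1" "1 - p = b / (a + b)"
      using pos by (simp_all add: p_def field_simps)
    have ab: "a + b = real (card S choose k)"
      by (simp add: a_def b_def card 3)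
    \<comment> \<open>The subsets that contain \<open>i\<close> and those that do not are treated by the induction hypothesis.\<close>
    have IH1: "(\<Sum>A\<in>nsets T k'. exp (f (insert i A))) \<le> a * exp (m1 + D T / (8 * real s))"
    proof -
      have "\<bar>f (insert i (insert j A)) - f (insert i (insert c A))\<bar> \<le> d j c"
        if "A \<subseteq> T" "j \<in> T - A" "c \<in> T - A" "j \<noteq> c" for A j c
        using Suc.prems(3)[of "insert i A" j c] that T by (auto simp: insert_commute)
      from Suc.hyps(1)[OF _ T(1) _ this, of k'] show ?thesis
        unfolding a_def m1_def F1_def D_def using T(4) 3 by simp
    qed
    have IH0: "(\<Sum>A\<in>nsets T (Suc k'). exp (f A)) \<le> b * exp (m0 + D T / (8 * real s))"
    proof -
      have "\<bar>f (insert j A) - f (insert c A)\<bar> \<le> d j c"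
        if "A \<subseteq> T" "j \<in> T - A" "c \<in> T - A" "j \<noteq> c" for A j c
        using that T by (intro Suc.prems(3)) auto
      from Suc.hyps(1)[OF _ T(1) _ this, of "Suc k'"] show ?thesis
        unfolding b_def m0_def F0_def D_def using T(4) 3 by simp
    qed
    have gap: "(m1 - m0)\<^sup>2 \<le> r / real s"
    proof -
      have "\<bar>f (insert i A) - f (insert c A)\<bar> \<le> d i c" if "A \<subseteq> T" "c \<in> T - A" for A c
        using that T by (intro Suc.prems(3)) auto
      from average_nsets_swap[where k = k' and f = f and i = i and d = "d i", OF T(1) _ this]
      have "\<bar>m1 - m0\<bar> \<le> (\<Sum>c\<in>T. d i c) / real s"
        unfolding m1_def m0_def F1_def F0_def a_def b_def using T(4) 3 by simp
      then have "\<bar>m1 - m0\<bar>\<^sup>2 \<le> ((\<Sum>c\<in>T. d i c) / real s)\<^sup>2"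
        by (intro power_mono) auto
      then have "(m1 - m0)\<^sup>2 \<le> ((\<Sum>c\<in>T. d i c) / real s)\<^sup>2"
        by simp
      also have "(\<Sum>c\<in>T. d i c)\<^sup>2 \<le> r * real s"
        using Cauchy_Schwarz_ineq_sum[of "\<lambda>_. 1" "d i" T] T by (simp add: r_def mult.commute)
      then have "((\<Sum>c\<in>T. d i c) / real s)\<^sup>2 \<le> r / real s"
        using s by (simp add: power_divide field_simps power2_eq_square)
      finally show ?thesis .
    qed
    have "(\<Sum>A\<in>nsets S k. exp (f A)) \<le>
        a * exp (m1 + D T / (8 * real s)) + b * exp (m0 + D T / (8 * real s))"
      using sum_nsets_insert[OF T(1,2), of "\<lambda>A. exp (f A)" k'] IH1 IH0 T 3 by simp
    also have "\<dots> = ((a + b) * p) * exp (m1 + D T / (8 * real s))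
        + ((a + b) * (1 - p)) * exp (m0 + D T / (8 * real s))"
    proof -
      have "(a + b) * p = a" using pos by (simp add: p_def)
      moreover have "(a + b) * (1 - p) = b" using pos p(3) by simp
      ultimately show ?thesis by simp
    qed
    also have "\<dots> = (a + b) * ((p * exp m1 + (1 - p) * exp m0) * exp (D T / (8 * real s)))"
      unfolding exp_add by algebra
    also have "\<dots> \<le> (a + b) * (exp (p * m1 + (1 - p) * m0 + (m1 - m0)\<^sup>2 / 8) * exp (D T / (8 * real s)))"
      using pos two_point_mgf_bound[OF p(1,2), of m1 m0]
      by (intro mult_left_mono mult_right_mono) simp_all
    also have "p * m1 + (1 - p) * m0 = (F1 + F0) / (a + b)"
    proof -
      have "p * m1 = F1 / (a + b)" using pos by (simp add: p_def m1_def)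
      moreover have "(1 - p) * m0 = F0 / (a + b)" using pos p(3) by (simp add: m0_def)
      ultimately show ?thesis by (simp add: add_divide_distrib)
    qed
    also have "F1 + F0 = (\<Sum>A\<in>nsets S k. f A)"
      using sum_nsets_insert[OF T(1,2), of f k'] T 3 by (simp add: F1_def F0_def)
    also have "(a + b) * (exp ((\<Sum>A\<in>nsets S k. f A) / (a + b) + (m1 - m0)\<^sup>2 / 8) * exp (D T / (8 * real s)))
      \<le> (a + b) * exp ((\<Sum>A\<in>nsets S k. f A) / (a + b) + D S / (8 * M))"
    proof -
      \<comment> \<open>The choice of \<open>i\<close> makes the variance proxy telescope.\<close>
      have "r + D T = D S - r" by (simp add: DS)
      also have "\<dots> \<le> D S - D S / M" using r by simp
      also have "\<dots> = real s * (D S / M)" using M by (simp add: field_simps)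
      finally have "(r + D T) / real s \<le> D S / M" using s by (simp add: field_simps)
      with gap have "(m1 - m0)\<^sup>2 + D T / real s \<le> D S / M"
        by (simp add: add_divide_distrib)
      then show ?thesis
        using pos by (simp flip: exp_add)
    qed
    finally show ?thesis by (simp add: ab D_def M_def)
  qed
qed

section \<open>Images of sets under a random permutation\<close>

lemma permutes_extending_injection:
  assumes "finite U" "I \<subseteq> U" "inj_on g I" "g ` I \<subseteq> U"
  shows "\<exists>\<tau>. \<tau> permutes U \<and> (\<forall>x\<in>I. \<tau> x = g x)"
proof -
  have "card (U - I) = card (U - g ` I)"
    using assms by (simp add: card_Diff_subset finite_subset card_image)
  then obtain h where h: "bij_betw h (U - I) (U - g ` I)"
    using assms finite_same_card_bij[of "U - I" "U - g ` I"] by auto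
  define \<tau> where "\<tau> = (\<lambda>x. if x \<in> I then g x else if x \<in> U then h x else x)"
  have "bij_betw \<tau> I (g ` I)"
    using assms by (simp add: \<tau>_def bij_betw_def inj_on_def)
  moreover have "bij_betw \<tau> (U - I) (U - g ` I)"
    using h by (rule bij_betw_cong[THEN iffD1, rotated]) (simp add: \<tau>_def)
  ultimately have "bij_betw \<tau> (I \<union> (U - I)) (g ` I \<union> (U - g ` I))"
    by (rule bij_betw_combine) auto
  moreover have "I \<union> (U - I) = U" "g ` I \<union> (U - g ` I) = U" using assms by auto
  ultimately have "bij_betw \<tau> U U" by simp
  then have "\<tau> permutes U"
    by (rule bij_imp_permutes) (use assms(2) in \<open>auto simp: \<tau>_def\<close>)
  then show ?thesis by (auto simp: \<tau>_def)
qed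

text \<open>
  For a uniform permutation, the images of two nested sets are uniformly distributed among the nested
  pairs of sets of the same sizes; the factor \<open>\<kappa>\<close> is the number of permutations that induce a given pair.
\<close>

lemma sum_permutations_images:
  fixes U :: "'a set"
  assumes "finite U" "I \<subseteq> U" "J \<subseteq> I"
  obtains \<kappa> :: real where "\<kappa> \<ge> 0"
    and "\<And>G. (\<Sum>b | b permutes U. G (b ` I) (b ` J)) =
           \<kappa> * (\<Sum>S\<in>nsets U (card I). \<Sum>A\<in>nsets S (card J). G S A)"
proof
  define P where "P = {b. b permutes U}"
  define \<Phi> where "\<Phi> = (\<lambda>b :: 'a \<Rightarrow> 'a. (b ` I, b ` J))"
  define fib where "fib = (\<lambda>y. {b \<in> P. \<Phi> b = y})"
  define T where "T = Sigma (nsets U (card I)) (\<lambda>S. nsets S (card J))"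
  have fin: "finite P" "finite I" "finite J"
    using assms finite_permutations by (auto simp: P_def intro: finite_subset)
  have finT: "finite T"
    unfolding T_def using assms(1)
    by (intro finite_SigmaI finite_imp_finite_nsets) (auto simp: nsets_def)
  \<comment> \<open>Composition with a permutation that maps \<open>(I, J)\<close> to \<open>(S, A)\<close> is a bijection between the fibres.\<close>
  have card_fib: "card (fib y) = card (fib (I, J))" if "y \<in> T" for y
  proof -
    obtain S A where y: "y = (S, A)" by fastforce
    have S: "S \<subseteq> U" "finite S" "card S = card I" and A: "A \<subseteq> S" "finite A" "card A = card J"
      using that by (auto simp: T_def nsets_def y)
    obtain g1 where g1: "bij_betw g1 J A"
      using finite_same_card_bij[of J A] fin A by auto
    have "card (I - J) = card (S - A)"
      using fin A S assms by (simp add: card_Diff_subset)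
    then obtain g2 where g2: "bij_betw g2 (I - J) (S - A)"
      using finite_same_card_bij[of "I - J" "S - A"] fin S by auto
    define g where "g = (\<lambda>x. if x \<in> J then g1 x else g2 x)"
    have gJ: "bij_betw g J A"
      using g1 by (rule bij_betw_cong[THEN iffD1, rotated]) (simp add: g_def)
    have gIJ: "bij_betw g (I - J) (S - A)"
      using g2 by (rule bij_betw_cong[THEN iffD1, rotated]) (simp add: g_def)
    have "bij_betw g (J \<union> (I - J)) (A \<union> (S - A))"
      using gJ gIJ by (rule bij_betw_combine) auto
    moreover have "J \<union> (I - J) = I" "A \<union> (S - A) = S" using assms A by auto
    ultimately have gI: "bij_betw g I S" by simp
    obtain \<tau> where \<tau>: "\<tau> permutes U" "\<forall>x\<in>I. \<tau> x = g x"
      using permutes_extending_injection[of U I g] assms S gI by (auto simp: bij_betw_def)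
    have im: "\<tau> ` I = S" "\<tau> ` J = A"
      using \<tau>(2) gI gJ assms(3) by (auto simp: bij_betw_def image_iff) (metis image_iff subsetD)+
    have invim: "inv \<tau> ` S = I" "inv \<tau> ` A = J"
      using \<tau>(1) im permutes_inverses(2)[OF \<tau>(1)]
      by (force simp: image_image simp flip: im)+
    have "bij_betw (\<lambda>b. \<tau> \<circ> b) (fib (I, J)) (fib y)"
    proof (rule bij_betw_byWitness[where f' = "\<lambda>b. inv \<tau> \<circ> b"])
      show "\<forall>b\<in>fib (I, J). inv \<tau> \<circ> (\<tau> \<circ> b) = b" "\<forall>b\<in>fib y. \<tau> \<circ> (inv \<tau> \<circ> b) = b"
        using permutes_inverses[OF \<tau>(1)] by (auto simp: fun_eq_iff)
      show "(\<lambda>b. \<tau> \<circ> b) ` fib (I, J) \<subseteq> fib y"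
      proof (rule image_subsetI)
        fix b assume "b \<in> fib (I, J)"
        then have b: "b permutes U" "b ` I = I" "b ` J = J" by (simp_all add: fib_def P_def \<Phi>_def)
        then show "\<tau> \<circ> b \<in> fib y"
          by (simp only: fib_def P_def \<Phi>_def y mem_Collect_eq prod.inject simp_thms
              image_comp[symmetric] im permutes_compose[OF b(1) \<tau>(1)])
      qed
      show "(\<lambda>b. inv \<tau> \<circ> b) ` fib y \<subseteq> fib (I, J)"
      proof (rule image_subsetI)
        fix b assume "b \<in> fib y"
        then have b: "b permutes U" "b ` I = S" "b ` J = A"
          by (simp_all add: fib_def P_def \<Phi>_def y)
        then show "inv \<tau> \<circ> b \<in> fib (I, J)"
          by (simp only: fib_def P_def \<Phi>_def mem_Collect_eq prod.inject simp_thms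
              image_comp[symmetric] invim permutes_compose[OF b(1) permutes_inv[OF \<tau>(1)]])
      qed
    qed
    then show ?thesis by (simp add: bij_betw_same_card)
  qed
  have sub: "\<Phi> ` P \<subseteq> T"
  proof
    fix y assume "y \<in> \<Phi> ` P"
    then obtain b where b: "b permutes U" and y: "y = (b ` I, b ` J)"
      by (auto simp: P_def \<Phi>_def)
    have inj: "inj b" using b by (rule permutes_inj)
    have "b ` I \<subseteq> U" using permutes_image[OF b] assms(2) by blast
    moreover have "card (b ` I) = card I" "card (b ` J) = card J"
      by (rule card_image[OF inj_on_subset[OF inj subset_UNIV]])+
    ultimately show "y \<in> T" using fin assms(3) by (auto simp: T_def y nsets_def)
  qed
  show "(\<Sum>b | b permutes U. G (b ` I) (b ` J)) =
      real (card (fib (I, J))) * (\<Sum>S\<in>nsets U (card I). \<Sum>A\<in>nsets S (card J). G S A)" for G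
  proof -
    have "(\<Sum>b | b permutes U. G (b ` I) (b ` J)) = (\<Sum>b\<in>P. case_prod G (\<Phi> b))"
      by (simp add: P_def \<Phi>_def)
    also have "\<dots> = (\<Sum>y\<in>T. \<Sum>b | b \<in> P \<and> \<Phi> b = y. case_prod G (\<Phi> b))"
      by (rule sum.group[symmetric]) (use fin finT sub in auto)
    also have "\<dots> = (\<Sum>y\<in>T. real (card (fib (I, J))) * case_prod G y)"
    proof (intro sum.cong refl)
      fix y assume "y \<in> T"
      have "(\<Sum>b | b \<in> P \<and> \<Phi> b = y. case_prod G (\<Phi> b)) = (\<Sum>b\<in>fib y. case_prod G y)"
        by (intro sum.cong) (auto simp: fib_def)
      then show "(\<Sum>b | b \<in> P \<and> \<Phi> b = y. case_prod G (\<Phi> b)) =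
          real (card (fib (I, J))) * case_prod G y"
        using card_fib[OF \<open>y \<in> T\<close>] by simp
    qed
    also have "\<dots> = real (card (fib (I, J))) *
        (\<Sum>S\<in>nsets U (card I). \<Sum>A\<in>nsets S (card J). G S A)"
      unfolding T_def sum_distrib_left[symmetric]
      by (subst sum.Sigma) (use assms(1) in \<open>auto simp: finite_imp_finite_nsets\<close>, auto simp: nsets_def)
    finally show ?thesis .
  qed
qed simp

lemma prob_permutation_images_le:
  assumes "finite U" "I \<subseteq> U" "J \<subseteq> I"
    and bound: "\<And>S. S \<in> nsets U (card I) \<Longrightarrow>
      real (card {A \<in> nsets S (card J). Q S A}) \<le> real (card I choose card J) * B"
  shows "measure_pmf.prob (pmf_of_set {b. b permutes U}) {b. Q (b ` I) (b ` J)} \<le> B"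
proof -
  define P where "P = {b. b permutes U}"
  have P: "finite P" "P \<noteq> {}"
    using finite_permutations[OF assms(1)] permutes_id[of U] unfolding P_def by blast+
  obtain \<kappa> :: real where \<kappa>: "\<kappa> \<ge> 0" "\<And>G. (\<Sum>b\<in>P. G (b ` I) (b ` J)) =
           \<kappa> * (\<Sum>S\<in>nsets U (card I). \<Sum>A\<in>nsets S (card J). G S A)"
    using sum_permutations_images[OF assms(1-3)] unfolding P_def by blast
  have ind: "(\<Sum>A\<in>nsets S (card J). of_bool (Q S A)) = real (card {A \<in> nsets S (card J). Q S A})"
    if "S \<in> nsets U (card I)" for S
    using that by (simp add: of_bool_def sum.If_cases finite_imp_finite_nsets nsets_def Int_def)
  have cP: "real (card P) = \<kappa> * (\<Sum>S\<in>nsets U (card I). real (card I choose card J))"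
  proof -
    have "card (nsets S (card J)) = card I choose card J" if "S \<in> nsets U (card I)" for S
      using that card_nsets[of S "card J"] by (simp add: nsets_def)
    then show ?thesis using \<kappa>(2)[of "\<lambda>_ _. 1"] by simp
  qed
  have "real (card (P \<inter> {b. Q (b ` I) (b ` J)})) = (\<Sum>b\<in>P. of_bool (Q (b ` I) (b ` J)))"
    using P by (simp add: of_bool_def sum.If_cases)
  also have "\<dots> = \<kappa> * (\<Sum>S\<in>nsets U (card I). \<Sum>A\<in>nsets S (card J). of_bool (Q S A))"
    by (rule \<kappa>(2))
  also have "\<dots> \<le> \<kappa> * (\<Sum>S\<in>nsets U (card I). real (card I choose card J) * B)"
    using \<kappa>(1) bound ind by (intro mult_left_mono sum_mono) auto
  also have "\<dots> = real (card P) * B"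
    unfolding cP by (simp add: sum_distrib_right mult.assoc)
  finally show ?thesis
    using P by (simp add: P_def[symmetric] measure_pmf_of_set field_simps card_gt_0_iff)
qed

section \<open>Second moment of a difference of means\<close>

lemma norm_sq_weighted_sum:
  fixes w :: "'a \<Rightarrow> 'h::real_inner"
  assumes "(\<Sum>i\<in>S. c i) = 0"
  shows "(norm (\<Sum>i\<in>S. c i *\<^sub>R w i))\<^sup>2 = - (\<Sum>i\<in>S. \<Sum>j\<in>S. c i * c j * (norm (w i - w j))\<^sup>2) / 2"
proof -
  have "(\<Sum>i\<in>S. \<Sum>j\<in>S. c i * c j * (norm (w i - w j))\<^sup>2) =
     (\<Sum>i\<in>S. \<Sum>j\<in>S. c i * (norm (w i))\<^sup>2 * c j) + (\<Sum>i\<in>S. \<Sum>j\<in>S. c i * (c j * (norm (w j))\<^sup>2))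
     - 2 * (\<Sum>i\<in>S. \<Sum>j\<in>S. inner (c i *\<^sub>R w i) (c j *\<^sub>R w j))"
    by (simp add: power2_norm_eq_inner inner_diff inner_commute algebra_simps
        sum.distrib sum_subtractf sum_distrib_left)
  also have "\<dots> = - 2 * (norm (\<Sum>i\<in>S. c i *\<^sub>R w i))\<^sup>2"
  proof -
    have "(\<Sum>i\<in>S. \<Sum>j\<in>S. inner (c i *\<^sub>R w i) (c j *\<^sub>R w j)) = (norm (\<Sum>i\<in>S. c i *\<^sub>R w i))\<^sup>2"
      unfolding power2_norm_eq_inner inner_sum_left by (simp only: inner_sum_right)
    then show ?thesis
      by (simp add: assms flip: sum_distrib_left sum_distrib_right)
  qed
  finally show ?thesis by simp
qed

text \<open>
  By exchangeability, the covariance of the weights of two distinct points does not depend on the points.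
\<close>

lemma sum_norm_sq_mean_difference:
  fixes w :: "'a \<Rightarrow> 'h::real_inner"
  assumes "finite S" "card S = n + m" "n > 0" "m > 0"
  shows "(\<Sum>A\<in>nsets S n. (norm ((1 / real n) *\<^sub>R (\<Sum>i\<in>A. w i) - (1 / real m) *\<^sub>R (\<Sum>i\<in>S - A. w i)))\<^sup>2)
     = real (card S choose n) * (\<Sum>i\<in>S. \<Sum>j\<in>S. (norm (w i - w j))\<^sup>2)
       / (2 * real n * real m * (real (n + m) - 1))"
proof -
  \<comment> \<open>The difference of means is a sum over \<open>S\<close> with random weights \<open>a A i\<close> of total \<open>0\<close>.\<close>
  define a where "a = (\<lambda>(A :: 'a set) i. if i \<in> A then 1 / real n else - 1 / real m)"
  define \<kappa> where "\<kappa> = (\<lambda>i j. \<Sum>A\<in>nsets S n. a A i * a A j)"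
  define C where "C = real (card S choose n)"
  define M where "M = real (n + m)"
  have M: "M > 1" using assms by (simp add: M_def)
  have split: "(\<Sum>i\<in>S. g (a A i) i) = (\<Sum>i\<in>A. g (1 / real n) i) + (\<Sum>i\<in>S - A. g (- 1 / real m) i)"
    if "A \<in> nsets S n" for A and g :: "real \<Rightarrow> 'a \<Rightarrow> 'b::comm_monoid_add"
  proof -
    have "A \<subseteq> S" using that by (simp add: nsets_def)
    then have "(\<Sum>i\<in>S. g (a A i) i) = (\<Sum>i\<in>S - A. g (a A i) i) + (\<Sum>i\<in>A. g (a A i) i)"
      using assms(1) by (rule sum.subset_diff)
    then show ?thesis by (simp add: a_def add.commute)
  qed
  have cardc: "card (S - A) = m" "card A = n" if "A \<in> nsets S n" for A
    using that assms by (auto simp: nsets_def card_Diff_subset)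
  have a0: "(\<Sum>i\<in>S. a A i) = 0" if "A \<in> nsets S n" for A
    using split[OF that, of "\<lambda>x i. x"] cardc[OF that] assms by simp
  have a2: "(\<Sum>i\<in>S. a A i * a A i) = M / (real n * real m)" if "A \<in> nsets S n" for A
    using split[OF that, of "\<lambda>x i. x * x"] cardc[OF that] assms by (simp add: M_def field_simps)
  have exch: "\<kappa> i j = \<kappa> i' j'"
    if ij: "i \<in> S" "j \<in> S" "i \<noteq> j" "i' \<in> S" "j' \<in> S" "i' \<noteq> j'" for i j i' j'
  proof -
    obtain \<tau> where \<tau>: "\<tau> permutes S" "\<tau> i = i'" "\<tau> j = j'"
      using permutes_extending_injection[of S "{i, j}" "\<lambda>x. if x = i then i' else j'"] ij assms(1)
      by (auto simp: inj_on_def)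
    have inj: "inj \<tau>" using \<tau>(1) by (rule permutes_inj)
    have bij: "bij_betw ((`) \<tau>) (nsets S n) (nsets S n)"
      by (intro bij_betw_nsets permutes_imp_bij \<tau>(1))
    have "a (\<tau> ` A) (\<tau> x) = a A x" for A x
      using inj by (simp add: a_def inj_image_mem_iff)
    then have "\<kappa> i j = (\<Sum>A\<in>nsets S n. a (\<tau> ` A) i' * a (\<tau> ` A) j')"
      unfolding \<kappa>_def \<tau>(2,3)[symmetric] by simp
    also have "\<dots> = \<kappa> i' j'"
      unfolding \<kappa>_def by (rule sum.reindex_bij_betw[OF bij])
    finally show ?thesis .
  qed
  \<comment> \<open>The weights add up to \<open>0\<close>, so their covariances do as well; this determines the common value
    of the off-diagonal ones.\<close>
  have \<kappa>: "\<kappa> i j = - C / (real n * real m * (M - 1))" if ij: "i \<in> S" "j \<in> S" "i \<noteq> j" for i j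
  proof -
    have "(\<Sum>x\<in>S. \<Sum>y\<in>S. \<kappa> x y) = (\<Sum>x\<in>S. \<Sum>A\<in>nsets S n. \<Sum>y\<in>S. a A x * a A y)"
      unfolding \<kappa>_def by (intro sum.cong refl sum.swap)
    also have "\<dots> = 0" by (simp add: a0 flip: sum_distrib_left)
    finally have "0 = (\<Sum>x\<in>S. \<Sum>y\<in>S. \<kappa> x y)" by simp
    also have "\<dots> = (\<Sum>x\<in>S. \<kappa> x x + (M - 1) * \<kappa> i j)"
    proof (intro sum.cong refl)
      fix x assume x: "x \<in> S"
      have "(\<Sum>y\<in>S. \<kappa> x y) = \<kappa> x x + (\<Sum>y\<in>S - {x}. \<kappa> x y)"
        using assms(1) x by (rule sum.remove)
      also have "(\<Sum>y\<in>S - {x}. \<kappa> x y) = (\<Sum>y\<in>S - {x}. \<kappa> i j)"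
        by (intro sum.cong refl exch) (use x ij in auto)
      also have "\<dots> = (M - 1) * \<kappa> i j"
        using assms x by (simp add: M_def of_nat_diff)
      finally show "(\<Sum>y\<in>S. \<kappa> x y) = \<kappa> x x + (M - 1) * \<kappa> i j" .
    qed
    also have "\<dots> = (\<Sum>x\<in>S. \<kappa> x x) + M * (M - 1) * \<kappa> i j"
      using assms by (simp add: sum.distrib M_def)
    also have "(\<Sum>x\<in>S. \<kappa> x x) = (\<Sum>A\<in>nsets S n. \<Sum>x\<in>S. a A x * a A x)"
      unfolding \<kappa>_def by (rule sum.swap)
    also have "\<dots> = C * (M / (real n * real m))"
      by (simp add: a2 C_def card_nsets)
    finally have "M * ((M - 1) * \<kappa> i j) = M * (- C / (real n * real m))"
      by (simp add: field_simps)
    then have "(M - 1) * \<kappa> i j = - C / (real n * real m)"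
      using M by (simp only: mult_cancel_left) simp
    then show ?thesis using M assms by (simp add: field_simps)
  qed
  have "(\<Sum>A\<in>nsets S n. (norm ((1 / real n) *\<^sub>R (\<Sum>i\<in>A. w i) - (1 / real m) *\<^sub>R (\<Sum>i\<in>S - A. w i)))\<^sup>2)
     = (\<Sum>A\<in>nsets S n. (norm (\<Sum>i\<in>S. a A i *\<^sub>R w i))\<^sup>2)"
  proof (intro sum.cong refl)
    fix A assume A: "A \<in> nsets S n"
    show "(norm ((1 / real n) *\<^sub>R (\<Sum>i\<in>A. w i) - (1 / real m) *\<^sub>R (\<Sum>i\<in>S - A. w i)))\<^sup>2
       = (norm (\<Sum>i\<in>S. a A i *\<^sub>R w i))\<^sup>2"
      using split[OF A, of "\<lambda>x i. x *\<^sub>R w i"] by (simp add: scaleR_sum_right sum_negf)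
  qed
  also have "\<dots> = (\<Sum>A\<in>nsets S n. - (\<Sum>i\<in>S. \<Sum>j\<in>S. a A i * a A j * (norm (w i - w j))\<^sup>2) / 2)"
    by (intro sum.cong refl norm_sq_weighted_sum a0)
  also have "\<dots> = - (\<Sum>A\<in>nsets S n. \<Sum>i\<in>S. \<Sum>j\<in>S. a A i * a A j * (norm (w i - w j))\<^sup>2) / 2"
    by (simp add: sum_negf flip: sum_divide_distrib)
  also have "(\<Sum>A\<in>nsets S n. \<Sum>i\<in>S. \<Sum>j\<in>S. a A i * a A j * (norm (w i - w j))\<^sup>2) =
     (\<Sum>i\<in>S. \<Sum>A\<in>nsets S n. \<Sum>j\<in>S. a A i * a A j * (norm (w i - w j))\<^sup>2)"
    by (rule sum.swap)
  also have "\<dots> = (\<Sum>i\<in>S. \<Sum>j\<in>S. \<kappa> i j * (norm (w i - w j))\<^sup>2)"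
    unfolding \<kappa>_def sum_distrib_right by (intro sum.cong refl sum.swap)
  also have "\<dots> = (\<Sum>i\<in>S. \<Sum>j\<in>S. - C / (real n * real m * (M - 1)) * (norm (w i - w j))\<^sup>2)"
  proof (intro sum.cong refl)
    fix i j assume "i \<in> S" "j \<in> S"
    then show "\<kappa> i j * (norm (w i - w j))\<^sup>2 = - C / (real n * real m * (M - 1)) * (norm (w i - w j))\<^sup>2"
      using \<kappa>[of i j] by (cases "i = j") auto
  qed
  also have "- \<dots> / 2 = C * (\<Sum>i\<in>S. \<Sum>j\<in>S. (norm (w i - w j))\<^sup>2) / (2 * real n * real m * (M - 1))"
    by (simp add: sum_negf sum_distrib_left sum_divide_distrib mult_ac)
  finally show ?thesis by (simp add: C_def M_def)
qed

section \<open>The sum of the largest values\<close>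

lemma sum_mset_le_take_sorted:
  fixes xs :: "real list"
  assumes "sorted_wrt (\<ge>) xs" "M \<subseteq># mset xs"
  shows "sum_mset M \<le> sum_list (take (size M) xs)"
  using assms
proof (induction xs arbitrary: M)
  case (Cons x xs)
  show ?case
  proof (cases "M = {#}")
    case False
    \<comment> \<open>Remove the largest value \<open>x\<close> from \<open>M\<close> if it occurs there, and an arbitrary element otherwise.\<close>
    then obtain y where y: "y \<in># M" "x \<in># M \<longrightarrow> y = x" by (metis multiset_nonemptyE)
    define M' where "M' = M - {#y#}"
    have M: "M = add_mset y M'" using y by (simp add: M'_def)
    have "y \<in># mset (x # xs)" using y(1) Cons.prems(2) by (rule mset_subset_eqD[rotated])
    then have "y \<le> x" using Cons.prems(1) by auto
    have "M' \<subseteq># mset xs"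
    proof (cases "x \<in># M")
      case True
      then show ?thesis using Cons.prems(2) M y by simp
    next
      case False
      have "count M a \<le> count (mset xs) a" for a
        using mset_subset_eq_count[OF Cons.prems(2), of a] False
        by (cases "a = x") (auto simp: not_in_iff)
      then have "M \<subseteq># mset xs" by (simp add: subseteq_mset_def)
      then show ?thesis unfolding M'_def by (rule subset_mset.order_trans[OF diff_subset_eq_self])
    qed
    then have "sum_mset M' \<le> sum_list (take (size M') xs)"
      using Cons by simp
    then show ?thesis using \<open>y \<le> x\<close> by (simp add: M)
  qed simp
qed simp

lemma sum_le_sum_largest:
  fixes g :: "'a \<Rightarrow> real"
  assumes "Q \<subseteq> set ps"
  shows "sum g Q \<le> sum_list (take (card Q) (rev (sort (map g ps))))"
proof -
  have fin: "finite Q" using assms finite_subset by blast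
  have "mset_set Q \<subseteq># mset_set (set ps)"
    using assms by (simp add: subset_imp_msubset_mset_set)
  also have "\<dots> \<subseteq># mset ps"
    using mset_set_set_mset_msubset[of "mset ps"] by simp
  finally have "image_mset g (mset_set Q) \<subseteq># mset (rev (sort (map g ps)))"
    by (simp add: image_mset_subseteq_mono)
  then have "sum_mset (image_mset g (mset_set Q)) \<le>
      sum_list (take (size (image_mset g (mset_set Q))) (rev (sort (map g ps))))"
    by (intro sum_mset_le_take_sorted) (simp add: sorted_wrt_rev)
  then show ?thesis using fin by (simp add: sum_unfold_sum_mset)
qed

lemma sum_pairwise_le_sigma_bar_sq:
  assumes "S \<subseteq> {1..N}" "card S = n k + n l" "n k + n l \<ge> 2"
    and sq: "\<And>x y. h_tilde h x y = (norm (\<psi> x - \<psi> y))\<^sup>2"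
  shows "(\<Sum>i\<in>S. \<Sum>j\<in>S. (norm (\<psi> (Z i) - \<psi> (Z j)))\<^sup>2)
    \<le> real (n k + n l) * (real (n k + n l) - 1) * sigma_bar_sq h Z N n k l"
proof -
  define c where "c = (n k + n l) * (n k + n l - 1)"
  define g where "g = (\<lambda>(i, j). h_tilde h (Z i) (Z j))"
  define ps where "ps = [(i, j). i \<leftarrow> [1..<Suc N], j \<leftarrow> [1..<Suc N], i \<noteq> j]"
  define Q where "Q = Sigma S (\<lambda>i. S - {i})"
  have fin: "finite S" using assms(1) finite_subset by blast
  have c: "c > 0" "real c = real (n k + n l) * (real (n k + n l) - 1)"
    using assms(3) by (auto simp: c_def of_nat_diff)
  have cQ: "card Q = c"
    unfolding Q_def c_def using fin assms(2) by (subst card_SigmaI) auto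
  have sorted: "sorted_h_tilde h Z N = rev (sort (map g ps))"
    unfolding sorted_h_tilde_def ps_def g_def
    by (simp add: map_concat o_def if_distrib cong: if_cong del: upt_Suc)
  have "(\<Sum>i\<in>S. \<Sum>j\<in>S. (norm (\<psi> (Z i) - \<psi> (Z j)))\<^sup>2) = (\<Sum>i\<in>S. \<Sum>j\<in>S - {i}. g (i, j))"
  proof (rule sum.cong[OF refl])
    fix i assume "i \<in> S"
    then show "(\<Sum>j\<in>S. (norm (\<psi> (Z i) - \<psi> (Z j)))\<^sup>2) = (\<Sum>j\<in>S - {i}. g (i, j))"
      using sum.remove[OF fin, of i "\<lambda>j. (norm (\<psi> (Z i) - \<psi> (Z j)))\<^sup>2"]
      by (simp add: g_def sq)
  qed
  also have "\<dots> = sum g Q"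
    unfolding Q_def using fin by (subst sum.Sigma) auto
  also have "\<dots> \<le> sum_list (take c (sorted_h_tilde h Z N))"
    unfolding sorted cQ[symmetric]
  proof (rule sum_le_sum_largest)
    have "set ps = {(i, j). i \<in> {1..N} \<and> j \<in> {1..N} \<and> i \<noteq> j}"
      by (auto simp: ps_def simp del: upt_Suc)
    then show "Q \<subseteq> set ps" using assms(1) by (auto simp: Q_def)
  qed
  also have "\<dots> = real c * sigma_bar_sq h Z N n k l"
    unfolding sigma_bar_sq_def Let_def c_def[symmetric] using c(1) by simp
  finally show ?thesis by (simp add: c(2))
qed

section \<open>Concentration of the permuted statistic\<close>

lemma card_index_pairs: "finite (index_pairs K)" "card (index_pairs K) = K choose 2"
proof -
  have "bij_betw (\<lambda>(k, l). {k, l}) (index_pairs K) (nsets {1..K} 2)"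
  proof (rule bij_betw_imageI)
    show "inj_on (\<lambda>(k, l). {k, l}) (index_pairs K)"
      by (auto simp: inj_on_def index_pairs_def doubleton_eq_iff)
    show "(\<lambda>(k, l). {k, l}) ` index_pairs K = nsets {1..K} 2"
      unfolding ordered_nsets_2_eq index_pairs_def by force
  qed
  then have "card (index_pairs K) = card (nsets {1..K} 2)" by (rule bij_betw_same_card)
  then show "card (index_pairs K) = K choose 2" by (simp add: card_nsets)
  show "finite (index_pairs K)"
    by (rule finite_subset[of _ "{1..K} \<times> {1..K}"]) (auto simp: index_pairs_def)
qed

text \<open>
  The bound for a fixed set \<open>S\<close> of pooled indices. If \<open>v = 0\<close>, all the vectors coincide on
  \<open>S\<close>, and no difference of means reaches the threshold.
\<close>

lemma two_sample_subset_tail: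
  fixes w :: "'a \<Rightarrow> 'h::real_inner" and v :: real
  assumes S: "finite S" "card S = n + m" "n > 0" "m > 0"
    and "v \<ge> 0" "t \<ge> 0" "v = 0 \<Longrightarrow> t > 0"
    and D: "(\<Sum>i\<in>S. \<Sum>j\<in>S. (norm (w i - w j))\<^sup>2) \<le> real (n + m) * (real (n + m) - 1) * v"
  defines "\<gamma> \<equiv> real n * real m / (real (n + m))\<^sup>2"
  shows "real (card {A \<in> nsets S n. t + sqrt (v / (2 * real (n + m) * \<gamma>)) \<le>
        norm ((1 / real n) *\<^sub>R (\<Sum>i\<in>A. w i) - (1 / real m) *\<^sub>R (\<Sum>i\<in>S - A. w i))})
    \<le> real (card S choose n) *
      (if v = 0 then 0 else exp (- (real (n + m) * \<gamma>\<^sup>2 * t\<^sup>2 / (2 * v))))"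
proof -
  define M where "M = real (n + m)"
  define C where "C = real (card S choose n)"
  define V where "V = (\<lambda>A. (1 / real n) *\<^sub>R (\<Sum>i\<in>A. w i) - (1 / real m) *\<^sub>R (\<Sum>i\<in>S - A. w i))"
  define D where "D = (\<Sum>i\<in>S. \<Sum>j\<in>S. (norm (w i - w j))\<^sup>2)"
  define \<mu> where "\<mu> = (\<Sum>A\<in>nsets S n. norm (V A)) / C"
  define q where "q = sqrt (v / (2 * M * \<gamma>))"
  define E where "E = {A \<in> nsets S n. t + q \<le> norm (V A)}"
  have M: "M \<ge> 2" and nm: "real n > 0" "real m > 0" "M = real n + real m"
    using S by (auto simp: M_def)
  have C: "C > 0" using S by (simp add: C_def)
  have fin: "finite (nsets S n)" using S(1) by (rule finite_imp_finite_nsets)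
  have q: "q\<^sup>2 = M * v / (2 * real n * real m)" "q \<ge> 0"
  proof -
    have "2 * M * \<gamma> = 2 * real n * real m / M"
      unfolding \<gamma>_def M_def[symmetric] using M by (simp add: power2_eq_square)
    then show "q\<^sup>2 = M * v / (2 * real n * real m)" "q \<ge> 0"
      using nm(1,2) M \<open>v \<ge> 0\<close> by (simp_all add: q_def mult.commute)
  qed
  have D_le: "D \<le> M * (M - 1) * v" using D by (simp add: D_def M_def)
  have sq: "(\<Sum>A\<in>nsets S n. (norm (V A))\<^sup>2) \<le> C * q\<^sup>2"
  proof -
    have "(\<Sum>A\<in>nsets S n. (norm (V A))\<^sup>2) = C * (D / (M - 1)) / (2 * real n * real m)"
      using sum_norm_sq_mean_difference[OF S, of w] by (simp add: V_def C_def D_def M_def)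
    also have "\<dots> \<le> C * (M * v) / (2 * real n * real m)"
      using D_le C nm M by (intro divide_right_mono mult_left_mono) (auto simp: field_simps)
    finally show ?thesis by (simp add: q(1))
  qed
  have goal: "real (card E) \<le> C * (if v = 0 then 0 else exp (- (M * \<gamma>\<^sup>2 * t\<^sup>2 / (2 * v))))"
  proof (cases "v = 0")
    case True
    then have "(\<Sum>A\<in>nsets S n. (norm (V A))\<^sup>2) \<le> 0" using sq q(1) by simp
    then have "(\<Sum>A\<in>nsets S n. (norm (V A))\<^sup>2) = 0" by (intro antisym sum_nonneg) auto
    then have "norm (V A) = 0" if "A \<in> nsets S n" for A
      using that fin by (simp add: sum_nonneg_eq_0_iff)
    then have "E = {}" using assms(7)[OF True] q(2) by (fastforce simp: E_def)
    then show ?thesis using True by simp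
  next
    case False
    then have v: "v > 0" using \<open>v \<ge> 0\<close> by simp
    define L where "L = 1 / real n + 1 / real m"
    \<comment> \<open>Exchanging two elements of \<open>S\<close> moves the difference of means by \<open>L\<close> times their distance,
      so \<open>L\<^sup>2 * D / M\<close> is a variance proxy; \<open>W\<close> bounds it.\<close>
    define W where "W = L\<^sup>2 * M * v"
    have L: "L > 0" "L = M / (real n * real m)" using nm by (simp_all add: L_def field_simps)
    have W: "W > 0" using L(1) M v by (simp add: W_def)
    \<comment> \<open>This value minimises \<open>\<theta>\<^sup>2 * W / 8 - \<theta> * t\<close>.\<close>
    define \<theta> where "\<theta> = 4 * t / W"
    have \<theta>: "\<theta> \<ge> 0" using W \<open>t \<ge> 0\<close> by (simp add: \<theta>_def)
    \<comment> \<open>The expectation is at most the root of the second moment.\<close>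
    have \<mu>: "\<mu> \<le> q"
    proof -
      have "(\<Sum>A\<in>nsets S n. norm (V A))\<^sup>2 \<le> C * (\<Sum>A\<in>nsets S n. (norm (V A))\<^sup>2)"
        using Cauchy_Schwarz_ineq_sum[of "\<lambda>_. 1" "\<lambda>A. norm (V A)" "nsets S n"]
        by (simp add: C_def card_nsets)
      also have "\<dots> \<le> C * (C * q\<^sup>2)" using sq C by simp
      finally have "(\<Sum>A\<in>nsets S n. norm (V A))\<^sup>2 \<le> (C * q)\<^sup>2"
        by (simp add: power2_eq_square mult_ac)
      then have "(\<Sum>A\<in>nsets S n. norm (V A)) \<le> C * q"
        by (rule power2_le_imp_le) (use C q in simp)
      then show ?thesis using C by (simp add: \<mu>_def field_simps)
    qed
    have swap: "\<bar>\<theta> * norm (V (insert i A)) - \<theta> * norm (V (insert c A))\<bar> \<le> \<theta> * L * norm (w i - w c)"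
      if A: "A \<subseteq> S" "i \<in> S - A" "c \<in> S - A" "i \<noteq> c" for A i c
    proof -
      have fA: "finite A" using A S finite_subset by blast
      define T where "T = S - insert i (insert c A)"
      have "S - insert i A = insert c T" "S - insert c A = insert i T"
        and T: "finite T" "c \<notin> T" "i \<notin> T"
        using A S(1) by (auto simp: T_def)
      then have "(\<Sum>x\<in>S - insert i A. w x) = w c + (\<Sum>x\<in>T. w x)"
        "(\<Sum>x\<in>S - insert c A. w x) = w i + (\<Sum>x\<in>T. w x)"
        by simp_all
      moreover have "(\<Sum>x\<in>insert i A. w x) = w i + (\<Sum>x\<in>A. w x)"
        "(\<Sum>x\<in>insert c A. w x) = w c + (\<Sum>x\<in>A. w x)" using A fA by simp_all
      ultimately have "V (insert i A) - V (insert c A) = L *\<^sub>R (w i - w c)"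
        by (simp add: V_def L_def algebra_simps)
      then have "\<bar>norm (V (insert i A)) - norm (V (insert c A))\<bar> \<le> L * norm (w i - w c)"
        using norm_triangle_ineq3[of "V (insert i A)" "V (insert c A)"] L(1) by simp
      then have "\<theta> * \<bar>norm (V (insert i A)) - norm (V (insert c A))\<bar> \<le> \<theta> * (L * norm (w i - w c))"
        using \<theta> by (rule mult_left_mono)
      then show ?thesis
        using \<theta> by (simp add: abs_mult mult.assoc flip: right_diff_distrib)
    qed
    have "(\<Sum>A\<in>nsets S n. exp (\<theta> * norm (V A))) \<le> C * exp ((\<Sum>A\<in>nsets S n. \<theta> * norm (V A)) / C
        + (\<Sum>i\<in>S. \<Sum>j\<in>S. (\<theta> * L * norm (w i - w j))\<^sup>2) / (8 * M))"
      unfolding C_def M_def S(2)[symmetric]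
      by (rule swap_lipschitz_mgf[where d = "\<lambda>i j. \<theta> * L * norm (w i - w j)"])
         (use S swap in \<open>auto simp: norm_minus_commute\<close>)
    also have "(\<Sum>A\<in>nsets S n. \<theta> * norm (V A)) / C = \<theta> * \<mu>"
      by (simp add: \<mu>_def sum_distrib_left)
    also have "(\<Sum>i\<in>S. \<Sum>j\<in>S. (\<theta> * L * norm (w i - w j))\<^sup>2) = \<theta>\<^sup>2 * L\<^sup>2 * D"
      by (simp add: D_def power_mult_distrib sum_distrib_left)
    also have "C * exp (\<theta> * \<mu> + \<theta>\<^sup>2 * L\<^sup>2 * D / (8 * M)) \<le> C * exp (\<theta> * q + \<theta>\<^sup>2 * W / 8)"
    proof -
      have "M * (M - 1) * v \<le> M * M * v"
        using M v by (intro mult_right_mono mult_left_mono) auto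
      with D_le have "D / M \<le> M * v" using M by (simp add: field_simps)
      then have "\<theta>\<^sup>2 * L\<^sup>2 * (D / M) / 8 \<le> \<theta>\<^sup>2 * L\<^sup>2 * (M * v) / 8"
        by (intro divide_right_mono mult_left_mono) auto
      then have "\<theta>\<^sup>2 * L\<^sup>2 * D / (8 * M) \<le> \<theta>\<^sup>2 * W / 8"
        by (simp add: W_def mult_ac)
      moreover have "\<theta> * \<mu> \<le> \<theta> * q" using \<theta> \<mu> by (rule mult_left_mono[rotated])
      ultimately have "\<theta> * \<mu> + \<theta>\<^sup>2 * L\<^sup>2 * D / (8 * M) \<le> \<theta> * q + \<theta>\<^sup>2 * W / 8"
        by (rule add_mono[rotated])
      then show ?thesis using C by (simp only: mult_le_cancel_left_pos exp_le_cancel_iff)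
    qed
    finally have mgf: "(\<Sum>A\<in>nsets S n. exp (\<theta> * norm (V A))) \<le> C * exp (\<theta> * q + \<theta>\<^sup>2 * W / 8)" .
    have "real (card E) * exp (\<theta> * (t + q)) = (\<Sum>A\<in>E. exp (\<theta> * (t + q)))" by simp
    also have "\<dots> \<le> (\<Sum>A\<in>E. exp (\<theta> * norm (V A)))"
      using \<theta> by (intro sum_mono) (auto simp: E_def intro: mult_left_mono)
    also have "\<dots> \<le> (\<Sum>A\<in>nsets S n. exp (\<theta> * norm (V A)))"
      by (intro sum_mono2 fin) (auto simp: E_def)
    also note mgf
    finally have "real (card E) \<le> C * exp (\<theta> * q + \<theta>\<^sup>2 * W / 8) / exp (\<theta> * (t + q))"
      by (simp add: pos_le_divide_eq)
    also have "\<dots> = C * exp (\<theta>\<^sup>2 * W / 8 - \<theta> * t)"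
    proof -
      have "\<theta> * q + \<theta>\<^sup>2 * W / 8 - \<theta> * (t + q) = \<theta>\<^sup>2 * W / 8 - \<theta> * t"
        by (simp add: algebra_simps)
      then show ?thesis by (simp flip: times_divide_eq_right exp_diff)
    qed
    also have "\<theta>\<^sup>2 * W / 8 - \<theta> * t = - 2 * t\<^sup>2 / W"
      using W by (simp add: \<theta>_def field_simps power2_eq_square)
    also have "C * exp (- 2 * t\<^sup>2 / W) \<le> C * exp (- (M * \<gamma>\<^sup>2 * t\<^sup>2 / (2 * v)))"
    proof -
      have "1 / W = M * \<gamma>\<^sup>2 / v"
        using nm(1,2) M v unfolding W_def L(2) \<gamma>_def M_def[symmetric]
        by (simp add: power2_eq_square field_simps)
      have "2 * t\<^sup>2 / W = 2 * t\<^sup>2 * (1 / W)" by simp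
      also have "\<dots> = 4 * (M * \<gamma>\<^sup>2 * t\<^sup>2 / (2 * v))"
        unfolding \<open>1 / W = M * \<gamma>\<^sup>2 / v\<close> using v by simp
      finally have "2 * t\<^sup>2 / W = 4 * (M * \<gamma>\<^sup>2 * t\<^sup>2 / (2 * v))" .
      moreover have "M * \<gamma>\<^sup>2 * t\<^sup>2 / (2 * v) \<ge> 0" using M v by simp
      ultimately have "- 2 * t\<^sup>2 / W \<le> - (M * \<gamma>\<^sup>2 * t\<^sup>2 / (2 * v))" by simp
      then show ?thesis using C by simp
    qed
    finally show ?thesis using False by simp
  qed
  then show ?thesis unfolding E_def V_def q_def C_def M_def .
qed

lemma two_sample_permutation_tail:
  fixes \<psi> :: "'x \<Rightarrow> 'h::{real_inner,complete_space}"
  assumes kl: "(k, l) \<in> index_pairs K" and n: "\<And>k. k \<in> {1..K} \<Longrightarrow> n k \<ge> 1"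
    and N: "N = (\<Sum>k=1..K. n k)"
    and sq: "\<And>x y. h_tilde h x y = (norm (\<psi> x - \<psi> y))\<^sup>2"
    and v: "sigma_bar_sq h Z N n k l \<le> v" "v \<ge> 0" and t: "t \<ge> 0" "v = 0 \<Longrightarrow> t > 0"
  shows "measure_pmf.prob (pmf_of_set {b. b permutes {1..N}})
      {b. t + sqrt (v / (2 * real (n k + n l) * gamma_ratio n k l))
          \<le> norm (permuted_mean \<psi> Z n b k - permuted_mean \<psi> Z n b l)}
    \<le> (if v = 0 then 0 else exp (- (real (n k + n l) * (gamma_ratio n k l)\<^sup>2 * t\<^sup>2 / (2 * v))))"
    (is "measure_pmf.prob ?P ?ev \<le> ?B")
proof -
  define blk where "blk = (\<lambda>k. {cum_size n (k - 1) + 1..cum_size n (k - 1) + n k})"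
  define I where "I = blk k \<union> blk l"
  define w where "w = (\<lambda>i. \<psi> (Z i))"
  define Q where "Q = (\<lambda>S A. t + sqrt (v / (2 * real (n k + n l) * gamma_ratio n k l)) \<le>
        norm ((1 / real (n k)) *\<^sub>R (\<Sum>i\<in>A. w i) - (1 / real (n l)) *\<^sub>R (\<Sum>i\<in>S - A. w i)))"
  have k: "k \<in> {1..K}" "l \<in> {1..K}" "k < l" using kl by (auto simp: index_pairs_def)
  have pos: "n k > 0" "n l > 0" using n[OF k(1)] n[OF k(2)] by auto
  have cum_Suc: "cum_size n (j - 1) + n j = cum_size n j" if "j \<in> {1..K}" for j
    using that by (cases j) (simp_all add: cum_size_def)
  have cum_mono: "cum_size n i \<le> cum_size n j" if "i \<le> j" for i j
    unfolding cum_size_def using that by (intro sum_mono2) auto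
  have blk_sub: "blk j \<subseteq> {1..N}" if "j \<in> {1..K}" for j
    using cum_Suc[OF that] cum_mono[of j K] that by (auto simp: blk_def N cum_size_def)
  have I: "I \<subseteq> {1..N}" using blk_sub k by (simp add: I_def)
  have disj: "blk k \<inter> blk l = {}"
  proof -
    have "cum_size n (k - 1) + n k \<le> cum_size n (l - 1)"
      using cum_Suc[OF k(1)] cum_mono[of k "l - 1"] k(3) by simp
    then show ?thesis by (auto simp: blk_def)
  qed
  have cards: "card (blk k) = n k" "card (blk l) = n l" by (simp_all add: blk_def)
  then have cI: "card I = n k + n l"
    unfolding I_def using disj by (subst card_Un_disjoint) (auto simp: blk_def)
  have mean: "permuted_mean \<psi> Z n b j = (1 / real (n j)) *\<^sub>R (\<Sum>i\<in>b ` blk j. w i)"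
    if b: "b permutes {1..N}" for b j
  proof -
    have "(\<Sum>i\<in>b ` blk j. w i) = (\<Sum>x\<in>blk j. w (b x))"
      using permutes_inj[OF b] by (subst sum.reindex) (auto intro: inj_on_subset)
    also have "\<dots> = (\<Sum>i=1..n j. \<psi> (Z (b (cum_size n (j - 1) + i))))"
      unfolding blk_def w_def
      using sum.shift_bounds_cl_nat_ivl[of "\<lambda>x. \<psi> (Z (b x))" 1 "cum_size n (j - 1)" "n j"]
      by (simp add: add.commute)
    finally show ?thesis by (simp add: permuted_mean_def)
  qed
  have "measure_pmf.prob ?P ?ev \<le> measure_pmf.prob ?P {b. Q (b ` I) (b ` blk k)}"
  proof (rule measure_pmf.finite_measure_mono_AE)
    have "Q (b ` I) (b ` blk k)" if b: "b permutes {1..N}" "b \<in> ?ev" for b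
    proof -
      have "b ` I - b ` blk k = b ` blk l"
        using permutes_inj[OF b(1)] disj by (auto simp: I_def inj_eq)
      then show ?thesis using b mean by (simp add: Q_def)
    qed
    moreover have "set_pmf ?P = {b. b permutes {1..N}}"
      by (intro set_pmf_of_set finite_permutations) (auto intro: permutes_id)
    ultimately show "AE b in ?P. b \<in> ?ev \<longrightarrow> b \<in> {b. Q (b ` I) (b ` blk k)}"
      by (auto simp: AE_measure_pmf_iff)
  qed simp
  also have "\<dots> \<le> ?B"
  proof (rule prob_permutation_images_le)
    fix S assume "S \<in> nsets {1..N} (card I)"
    then have S: "S \<subseteq> {1..N}" "finite S" "card S = n k + n l" by (auto simp: nsets_def cI)
    have "(\<Sum>i\<in>S. \<Sum>j\<in>S. (norm (w i - w j))\<^sup>2)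
        \<le> real (n k + n l) * (real (n k + n l) - 1) * sigma_bar_sq h Z N n k l"
      unfolding w_def by (rule sum_pairwise_le_sigma_bar_sq) (use S pos sq in auto)
    also have "\<dots> \<le> real (n k + n l) * (real (n k + n l) - 1) * v"
      using v(1) pos by (intro mult_left_mono) auto
    finally have D: "(\<Sum>i\<in>S. \<Sum>j\<in>S. (norm (w i - w j))\<^sup>2)
        \<le> real (n k + n l) * (real (n k + n l) - 1) * v" .
    show "real (card {A \<in> nsets S (card (blk k)). Q S A})
        \<le> real (card I choose card (blk k)) * ?B"
      using two_sample_subset_tail[OF S(2,3) pos v(2) t D]
      unfolding Q_def gamma_ratio_def cards cI S(3) .
  qed (use I in \<open>auto simp: I_def\<close>)
  finally show ?thesis .
qed

theorem theorem5p2: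
  fixes evalf :: "'h::{real_inner,complete_space} \<Rightarrow> 'x \<Rightarrow> real"
    and h :: "'x \<Rightarrow> 'x \<Rightarrow> real"
    and \<psi> :: "'x \<Rightarrow> 'h"
    and K N :: nat
    and n :: "nat \<Rightarrow> nat"
    and X :: "nat \<Rightarrow> nat \<Rightarrow> 'x"
    and Z :: "nat \<Rightarrow> 'x"
    and \<sigma>2 t :: real
  assumes "rkhs evalf"
    and "reproducing_kernel evalf h"
    and "feature_map \<psi> h"
    and "K \<ge> 2"
    and "\<And>k. k \<in> {1..K} \<Longrightarrow> n k \<ge> 1"
    and "N = (\<Sum>k=1..K. n k)"
    and "Z = pooled_sample K n X"
    and "\<sigma>2 = sigma_hat_sq h Z N K n"
    and "t \<ge> 0"
  shows "measure_pmf.prob (pmf_of_set {b. b permutes {1..N}})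
           {b. V_max \<psi> Z K n b \<ge>
               t + Max ((\<lambda>(k, l). sqrt (\<sigma>2 / (2 * real (n k + n l) * gamma_ratio n k l))) ` index_pairs K)}
         \<le> real (K choose 2) *
            (if \<sigma>2 = 0 then (if t > 0 then 0 else 1)
             else exp (- Min ((\<lambda>(k, l). real (n k + n l) * (gamma_ratio n k l)\<^sup>2 * t\<^sup>2 / (2 * \<sigma>2))
                              ` index_pairs K)))"
    (is "measure_pmf.prob ?P ?ev \<le> real (K choose 2) * ?R")
proof (cases "\<sigma>2 = 0 \<and> t = 0")
  case True
  have "K choose 2 \<ge> 1" using \<open>K \<ge> 2\<close> by (simp add: Suc_le_eq)
  then have "1 \<le> real (K choose 2) * ?R" using True by simp
  then show ?thesis by (rule order.trans[OF measure_pmf.prob_le_1])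
next
  case False
  define q where "q = (\<lambda>k l. sqrt (\<sigma>2 / (2 * real (n k + n l) * gamma_ratio n k l)))"
  define F where "F = (\<lambda>k l. {b. t + q k l \<le> norm (permuted_mean \<psi> Z n b k - permuted_mean \<psi> Z n b l)})"
  have fin: "finite (index_pairs K)" by (rule card_index_pairs)
  have ne: "index_pairs K \<noteq> {}"
  proof -
    have "(1, 2) \<in> index_pairs K" using \<open>K \<ge> 2\<close> by (simp add: index_pairs_def)
    then show ?thesis by blast
  qed
  have sq: "h_tilde h x y = (norm (\<psi> x - \<psi> y))\<^sup>2" for x y
    using assms(3) by (simp add: feature_map_def h_tilde_def power2_norm_eq_inner inner_diff inner_commute)
  have bar_le: "sigma_bar_sq h Z N n k l \<le> \<sigma>2" if "(k, l) \<in> index_pairs K" for k l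
    unfolding assms(8) sigma_hat_sq_def using fin that by (intro Max_ge) force+
  have nonneg: "\<sigma>2 \<ge> 0"
  proof -
    obtain k l where kl: "(k, l) \<in> index_pairs K" using ne by fast
    have "\<forall>x\<in>set (sorted_h_tilde h Z N). x \<ge> 0"
      by (auto simp: sorted_h_tilde_def sq)
    then have "sigma_bar_sq h Z N n k l \<ge> 0"
      unfolding sigma_bar_sq_def Let_def
      by (intro divide_nonneg_nonneg sum_list_nonneg) (auto dest: in_set_takeD)
    then show ?thesis using bar_le[OF kl] by simp
  qed
  have pair: "measure_pmf.prob ?P (F k l) \<le> ?R" if kl: "(k, l) \<in> index_pairs K" for k l
  proof -
    have "measure_pmf.prob ?P (F k l) \<le>
        (if \<sigma>2 = 0 then 0 else exp (- (real (n k + n l) * (gamma_ratio n k l)\<^sup>2 * t\<^sup>2 / (2 * \<sigma>2))))"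
      unfolding F_def q_def
      by (rule two_sample_permutation_tail[OF kl assms(5,6) sq bar_le[OF kl] nonneg \<open>t \<ge> 0\<close>])
         (use False \<open>t \<ge> 0\<close> in auto)
    also have "\<dots> \<le> ?R"
      using False \<open>t \<ge> 0\<close> kl fin by (auto intro!: Min_le)
    finally show ?thesis .
  qed
  have "?ev \<subseteq> (\<Union>(k, l)\<in>index_pairs K. F k l)"
  proof
    fix b assume b: "b \<in> ?ev"
    have "V_max \<psi> Z K n b \<in>
        (\<lambda>(k, l). norm (permuted_mean \<psi> Z n b k - permuted_mean \<psi> Z n b l)) ` index_pairs K"
      unfolding V_max_def using fin ne by (intro Max_in) auto
    then obtain k l where kl: "(k, l) \<in> index_pairs K"
      and V: "V_max \<psi> Z K n b = norm (permuted_mean \<psi> Z n b k - permuted_mean \<psi> Z n b l)" by auto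
    have "q k l \<le> Max ((\<lambda>(k, l). q k l) ` index_pairs K)"
      using fin kl by (intro Max_ge) force+
    then have "b \<in> F k l" using b V by (simp add: F_def q_def)
    then show "b \<in> (\<Union>(k, l)\<in>index_pairs K. F k l)" using kl by blast
  qed
  then have "measure_pmf.prob ?P ?ev \<le> measure_pmf.prob ?P (\<Union>p\<in>index_pairs K. F (fst p) (snd p))"
    by (intro measure_pmf.finite_measure_mono) (auto simp: case_prod_unfold)
  also have "\<dots> \<le> (\<Sum>p\<in>index_pairs K. measure_pmf.prob ?P (F (fst p) (snd p)))"
    using fin by (intro measure_pmf.finite_measure_subadditive_finite) auto
  also have "\<dots> \<le> (\<Sum>p\<in>index_pairs K. ?R)"
    by (intro sum_mono pair) simp
  also have "\<dots> = real (K choose 2) * ?R" by (simp add: card_index_pairs)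
  finally show ?thesis .
qed

end
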